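(* Let $K$ be a field, $E$ a graph with finitely many vertices, and $v$ and $w$ vertices in $E$ (they may be the same). Let $e_1$ and $e_2$ be two distinct edges in $E$ with $s(e_i) = v$ and $r(e_i) = w$ for $i=1,2$. Let $A_E(e_1, e_2)$ be the $K$-subalgebra of $L_K(E)$ generated by the sets $E^0$, $E^1\setminus \{e_2\}$ and $\{e^*\mid e\in E^1\setminus \{e_1\}\}$. Then, for any $p\in A_E(e_1, e_2)$ with $wp = pw$, there exists a unique automorphism $\sigma_p$ of the $K$-algebra $L_K(E)$ satisfying $$\sigma _p(e_2)=e_2+e_1p,\quad \sigma_p(e_1^* )=e_1^*-pe_2^* ,\quad \sigma^{-1}_p(e_2)=e_2 - e_1p,\quad \sigma^{-1}_p(e_1^* )=e_1^* +pe_2^*$$ and $\sigma_p(q) = q$ for all $q\in A_E(e_1, e_2)$.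
   Context: A (directed) graph $E=(E^0,E^1,s,r)$ consists of two disjoint sets $E^0$ (vertices) and $E^1$ (edges) with maps $s,r:E^1\to E^0$ (source and range). A vertex $v$ is regular if $0<|s^{-1}(v)|<\infty$. For a field $K$, the Leavitt path algebra $L_K(E)$ is the $K$-algebra generated by the union of $E^0$ and two disjoint copies $E^1$ and $\{e^*\mid e\in E^1\}$ of $E^1$, subject to the following relations for all $v,w\in E^0$ and $e,f\in E^1$: (1) $vw=\delta_{v,w}w$; (2) $s(e)e=e=e\,r(e)$ and $e^*s(e)=e^*=r(e)e^*$; (3) $e^*f=\delta_{e,f}r(e)$; (4) $v=\sum_{e\in s^{-1}(v)}ee^*$ for every regular vertex $v$. If $E^0$ is finite, $L_K(E)$ is unital with identity $1=\sum_{v\in E^0}v$. *)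

theory Defs
  imports
    "HOL-Library.Poly_Mapping"
    "HOL-Algebra.QuotRing"
    "HOL-Algebra.Module"
    "Graph_Theory.Digraph"
begin

section \<open>Free associative algebras\<close>

text \<open>
  The multiplication of \<^typ>\<open>'a \<Rightarrow>\<^sub>0 'k\<close> is convolution with respect to the (not necessarily
  commutative) monoid written additively on the exponents. With words under concatenation as
  exponents it is the multiplication of noncommutative polynomials.
\<close>

datatype 'g word = Word (letters: "'g list")

instantiation word :: (type) monoid_add
begin

definition zero_word :: "'a word" where
  "0 = Word []"

definition plus_word :: "'a word \<Rightarrow> 'a word \<Rightarrow> 'a word" where
  "u + w = Word (letters u @ letters w)"

instance
  by standard (auto simp: zero_word_def plus_word_def)

end

type_synonym ('g, 'k) ncpoly = "'g word \<Rightarrow>\<^sub>0 'k"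

definition gen :: "'g \<Rightarrow> ('g, 'k::field) ncpoly" where
  "gen g = Poly_Mapping.single (Word [g]) 1"

definition scalar :: "'k \<Rightarrow> ('g, 'k::field) ncpoly" where
  "scalar k = Poly_Mapping.single 0 k"

definition free_algebra :: "'g set \<Rightarrow> ('g, 'k::field) ncpoly ring" where
  "free_algebra G =
    \<lparr>carrier = {x. \<forall>u \<in> Poly_Mapping.keys x. set (letters u) \<subseteq> G},
     mult = (*), one = 1, zero = 0, add = (+)\<rparr>"

section \<open>Leavitt path algebras\<close>

datatype ('v, 'e) lpa_gen = Vertex 'v | Edge 'e | Ghost 'e

type_synonym ('v, 'e, 'k) lpa_elem = "(('v, 'e) lpa_gen, 'k) ncpoly set"

definition lpa_gens :: "('v, 'e) pre_digraph \<Rightarrow> ('v, 'e) lpa_gen set" where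
  "lpa_gens E = Vertex ` verts E \<union> Edge ` arcs E \<union> Ghost ` arcs E"

definition regular_vertex :: "('v, 'e) pre_digraph \<Rightarrow> 'v \<Rightarrow> bool" where
  "regular_vertex E v \<longleftrightarrow> v \<in> verts E \<and> out_arcs E v \<noteq> {} \<and> finite (out_arcs E v)"

definition lpa_relators ::
    "('v, 'e) pre_digraph \<Rightarrow> (('v, 'e) lpa_gen, 'k::field) ncpoly set" where
  "lpa_relators E =
    {gen (Vertex v) * gen (Vertex w) - (if v = w then gen (Vertex w) else 0) | v w.
       v \<in> verts E \<and> w \<in> verts E} \<union>
    {gen (Vertex (tail E e)) * gen (Edge e) - gen (Edge e) | e. e \<in> arcs E} \<union>
    {gen (Edge e) * gen (Vertex (head E e)) - gen (Edge e) | e. e \<in> arcs E} \<union>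
    {gen (Ghost e) * gen (Vertex (tail E e)) - gen (Ghost e) | e. e \<in> arcs E} \<union>
    {gen (Vertex (head E e)) * gen (Ghost e) - gen (Ghost e) | e. e \<in> arcs E} \<union>
    {gen (Ghost e) * gen (Edge f) - (if e = f then gen (Vertex (head E e)) else 0) | e f.
       e \<in> arcs E \<and> f \<in> arcs E} \<union>
    {gen (Vertex v) - (\<Sum>e\<in>out_arcs E v. gen (Edge e) * gen (Ghost e)) | v.
       regular_vertex E v}"

definition lpa_ideal ::
    "('v, 'e) pre_digraph \<Rightarrow> (('v, 'e) lpa_gen, 'k::field) ncpoly set" where
  "lpa_ideal E = genideal (free_algebra (lpa_gens E)) (lpa_relators E)"

definition lpa_class ::
    "('v, 'e) pre_digraph \<Rightarrow> (('v, 'e) lpa_gen, 'k::field) ncpoly \<Rightarrow> ('v, 'e, 'k) lpa_elem" where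
  "lpa_class E x = lpa_ideal E +>\<^bsub>free_algebra (lpa_gens E)\<^esub> x"

text \<open>
  The presentation is one of a not necessarily unital algebra. The free non-unital algebra on
  the generators is the set of noncommutative polynomials without constant term. All relators lie
  in it, and the two-sided ideal they generate there is the same as the one they generate in the
  free unital algebra. So the Leavitt path algebra consists of the cosets of polynomials without
  constant term, inside the quotient of the free unital algebra. (The class of the polynomial 1
  is in general not one of these cosets.) If the graph has finitely many vertices, the identity
  is the sum of the vertices; for infinitely many vertices the \<open>one\<close> field is meaningless.
\<close>

definition leavitt_path_algebra ::
    "('v, 'e) pre_digraph \<Rightarrow> ('k::field, ('v, 'e, 'k) lpa_elem) module" where
  "leavitt_path_algebra E =
    (let F = free_algebra (lpa_gens E); Q = F Quot lpa_ideal E in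
     \<lparr>carrier = lpa_class E ` {x \<in> carrier F. Poly_Mapping.lookup x 0 = 0},
      mult = mult Q,
      one = lpa_class E (\<Sum>v\<in>verts E. gen (Vertex v)),
      zero = zero Q,
      add = add Q,
      smult = (\<lambda>k X. \<Union>x\<in>X. lpa_class E (scalar k * x))\<rparr>)"

definition lpa_vertex :: "('v, 'e) pre_digraph \<Rightarrow> 'v \<Rightarrow> ('v, 'e, 'k::field) lpa_elem" where
  "lpa_vertex E v = lpa_class E (gen (Vertex v))"

definition lpa_edge :: "('v, 'e) pre_digraph \<Rightarrow> 'e \<Rightarrow> ('v, 'e, 'k::field) lpa_elem" where
  "lpa_edge E e = lpa_class E (gen (Edge e))"

definition lpa_ghost :: "('v, 'e) pre_digraph \<Rightarrow> 'e \<Rightarrow> ('v, 'e, 'k::field) lpa_elem" where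
  "lpa_ghost E e = lpa_class E (gen (Ghost e))"

section \<open>Subalgebras and automorphisms\<close>

definition is_subalgebra :: "('k::field, 'a) module \<Rightarrow> 'a set \<Rightarrow> bool" where
  "is_subalgebra L B \<longleftrightarrow>
     B \<subseteq> carrier L \<and> \<zero>\<^bsub>L\<^esub> \<in> B \<and>
     (\<forall>x\<in>B. \<forall>y\<in>B. x \<oplus>\<^bsub>L\<^esub> y \<in> B) \<and>
     (\<forall>x\<in>B. \<forall>y\<in>B. x \<otimes>\<^bsub>L\<^esub> y \<in> B) \<and>
     (\<forall>k. \<forall>x\<in>B. k \<odot>\<^bsub>L\<^esub> x \<in> B)"

definition generated_subalgebra :: "('k::field, 'a) module \<Rightarrow> 'a set \<Rightarrow> 'a set" where
  "generated_subalgebra L S = \<Inter>{B. is_subalgebra L B \<and> S \<subseteq> B}"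

text \<open>Extensionality makes automorphisms equal as soon as they agree on the carrier.\<close>

definition algebra_auto :: "('k::field, 'a) module \<Rightarrow> ('a \<Rightarrow> 'a) set" where
  "algebra_auto L =
    {\<sigma> \<in> ring_iso L L \<inter> extensional (carrier L).
       \<forall>k. \<forall>x\<in>carrier L. \<sigma> (k \<odot>\<^bsub>L\<^esub> x) = k \<odot>\<^bsub>L\<^esub> \<sigma> x}"

text \<open>No identity has to be added to the generators: it is the sum of all vertices when there are
  finitely many of them.\<close>

definition lpa_two_edge_subalgebra ::
    "('v, 'e) pre_digraph \<Rightarrow> 'e \<Rightarrow> 'e \<Rightarrow> ('v, 'e, 'k::field) lpa_elem set" where
  "lpa_two_edge_subalgebra E e\<^sub>1 e\<^sub>2 =
     generated_subalgebra (leavitt_path_algebra E)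
       (lpa_vertex E ` verts E \<union> lpa_edge E ` (arcs E - {e\<^sub>2}) \<union> lpa_ghost E ` (arcs E - {e\<^sub>1}))"

end

theory Submission
  imports Defs
begin

text \<open>
  Everything happens in the free algebra. Lift \<open>p\<close> to a polynomial \<open>P\<close> in which neither
  \<open>e\<^sub>2\<close> nor \<open>e\<^sub>1\<^sup>*\<close> occurs. The substitution \<open>e\<^sub>2 \<mapsto> e\<^sub>2 + e\<^sub>1 P\<close>,
  \<open>e\<^sub>1\<^sup>* \<mapsto> e\<^sub>1\<^sup>* - P e\<^sub>2\<^sup>*\<close> then fixes \<open>P\<close>, so the substitution belonging to \<open>-P\<close> is its
  inverse already on the free algebra, and it fixes every lift of an element of the subalgebra.
  It maps the Leavitt ideal into itself: the relation (4) at \<open>v\<close> is preserved because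
  \<open>e\<^sub>1 (e\<^sub>1\<^sup>* - P e\<^sub>2\<^sup>*) + (e\<^sub>2 + e\<^sub>1 P) e\<^sub>2\<^sup>* = e\<^sub>1 e\<^sub>1\<^sup>* + e\<^sub>2 e\<^sub>2\<^sup>*\<close>, and the relation
  \<open>e\<^sub>1\<^sup>* e\<^sub>2 = 0\<close> because \<open>(e\<^sub>1\<^sup>* - P e\<^sub>2\<^sup>*) (e\<^sub>2 + e\<^sub>1 P)\<close> is congruent to \<open>w P - P w\<close>.
  Uniqueness holds since two automorphisms agree on a subalgebra.
\<close>

section \<open>Noncommutative polynomials\<close>

text \<open>One notion covers all the monomial subspaces that occur: \<open>lists G\<close> gives
  the free algebra, \<open>lists G - {[]}\<close> the polynomials without constant term, and
  \<open>{[]}\<close> the constants. Closure under products then reduces to concatenation of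
  words.\<close>

definition word_span :: "'g list set \<Rightarrow> ('g, 'k::field) ncpoly set" where
  "word_span W = {x. \<forall>u\<in>Poly_Mapping.keys x. letters u \<in> W}"

lemma carrier_free_algebra: "carrier (free_algebra G) = word_span (lists G)"
  by (auto simp: free_algebra_def word_span_def)

lemma word_span_mono: "W \<subseteq> W' \<Longrightarrow> word_span W \<subseteq> word_span W'"
  by (auto simp: word_span_def)

lemma zero_in_word_span [simp]: "0 \<in> word_span W"
  by (simp add: word_span_def)

lemma word_span_add: "x \<in> word_span W \<Longrightarrow> y \<in> word_span W \<Longrightarrow> x + y \<in> word_span W"
  using keys_add[of x y] by (auto simp: word_span_def)

lemma word_span_uminus: "x \<in> word_span W \<Longrightarrow> - x \<in> word_span W"
  by (simp add: word_span_def)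

lemma word_span_diff: "x \<in> word_span W \<Longrightarrow> y \<in> word_span W \<Longrightarrow> x - y \<in> word_span W"
  using word_span_add[of x W "- y"] word_span_uminus[of y W] by simp

lemma word_span_sum: "(\<And>i. i \<in> I \<Longrightarrow> f i \<in> word_span W) \<Longrightarrow> sum f I \<in> word_span W"
  by (induction I rule: infinite_finite_induct) (auto intro: word_span_add)

lemma word_span_mult:
  assumes "x \<in> word_span W" "y \<in> word_span W'"
    and "\<And>u v. u \<in> W \<Longrightarrow> v \<in> W' \<Longrightarrow> u @ v \<in> W''"
  shows "x * y \<in> word_span W''"
  using assms keys_mult[of x y] by (fastforce simp: word_span_def plus_word_def)

lemma one_in_word_span: "[] \<in> W \<Longrightarrow> 1 \<in> word_span W"
  by (simp add: word_span_def zero_word_def)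

lemma single_in_word_span: "letters u \<in> W \<Longrightarrow> Poly_Mapping.single u c \<in> word_span W"
  by (simp add: word_span_def)

lemma gen_in_word_span: "[g] \<in> W \<Longrightarrow> gen g \<in> word_span W"
  by (simp add: gen_def single_in_word_span)

lemma scalar_mult_in_word_span:
  assumes "x \<in> word_span W"
  shows "scalar k * x \<in> word_span W"
proof -
  have "scalar k \<in> word_span {[]}"
    by (simp add: scalar_def single_in_word_span zero_word_def)
  then show ?thesis
    by (rule word_span_mult) (use assms in auto)
qed

section \<open>Decomposition into monomials and central scalars\<close>

lemma ncpoly_eq_sum_single:
  fixes x :: "('g, 'k::field) ncpoly"
  shows "x = (\<Sum>u\<in>Poly_Mapping.keys x. Poly_Mapping.single u (Poly_Mapping.lookup x u))"
  by (rule poly_mapping_eqI)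
     (auto simp: lookup_sum lookup_single when_def in_keys_iff)

text \<open>A polynomial is the sum of its own monomials, whose words all lie in \<open>W\<close>.
  The inner induction adds them one at a time along finite subsets of the support.\<close>

lemma word_span_induct [consumes 1, case_names zero single add]:
  fixes x :: "('g, 'k::field) ncpoly"
  assumes "x \<in> word_span W"
    and zero: "P 0"
    and single: "\<And>u c. u \<in> W \<Longrightarrow> P (Poly_Mapping.single (Word u) c)"
    and add: "\<And>x y. P x \<Longrightarrow> P y \<Longrightarrow> P (x + y)"
  shows "P x"
proof -
  have "P (\<Sum>u\<in>A. Poly_Mapping.single u (Poly_Mapping.lookup x u))"
    if "finite A" "A \<subseteq> Poly_Mapping.keys x" for A
    using that
  proof (induction A rule: finite_induct)
    case (insert u A)
    then have "letters u \<in> W"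
      using assms(1) by (auto simp: word_span_def)
    from single[OF this] have "P (Poly_Mapping.single u (Poly_Mapping.lookup x u))"
      by simp
    then show ?case
      using insert by (auto intro: add)
  qed (simp add: zero)
  from this[of "Poly_Mapping.keys x"] show ?thesis
    using ncpoly_eq_sum_single[of x] by simp
qed

lemma ncpoly_induct [case_names zero single add]:
  fixes x :: "('g, 'k::field) ncpoly"
  assumes "P 0" and "\<And>u c. P (Poly_Mapping.single (Word u) c)"
    and "\<And>x y. P x \<Longrightarrow> P y \<Longrightarrow> P (x + y)"
  shows "P x"
proof -
  have "x \<in> word_span UNIV"
    by (simp add: word_span_def)
  then show ?thesis
    by (induction rule: word_span_induct) (auto intro: assms)
qed

lemma scalar_0 [simp]: "scalar 0 = 0"
  by (simp add: scalar_def)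

lemma scalar_1 [simp]: "scalar 1 = 1"
  by (simp add: scalar_def)

lemma scalar_add: "scalar (a + b) = scalar a + scalar b"
  by (simp add: scalar_def single_add)

lemma scalar_mult: "scalar (a * b) = scalar a * scalar b"
  by (simp add: scalar_def mult_single)

text \<open>Scalars sit at the empty word, which is neutral for concatenation, and the field is
  commutative; so they are central.\<close>

lemma scalar_commute: "x * scalar k = scalar k * x"
  by (induction x rule: ncpoly_induct)
     (simp_all add: scalar_def mult_single distrib_left distrib_right mult.commute)

lemma single_Word_conv:
  "Poly_Mapping.single (Word u) c = scalar c * prod_list (map gen u)"
proof -
  have "Poly_Mapping.single (Word u) (1::'b) = prod_list (map gen u)"
  proof (induction u)
    case (Cons g u)
    have "Poly_Mapping.single (Word (g # u)) (1::'b) = gen g * Poly_Mapping.single (Word u) 1"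
      by (simp add: gen_def mult_single plus_word_def)
    then show ?case
      using Cons by simp
  qed (simp flip: zero_word_def)
  moreover have "Poly_Mapping.single (Word u) c = scalar c * Poly_Mapping.single (Word u) 1"
    by (simp add: scalar_def mult_single)
  ultimately show ?thesis
    by simp
qed

section \<open>Substitution of generators\<close>

text \<open>This realizes the universal property of the free algebra: it is the unital algebra
  homomorphism extending the assignment \<open>h\<close> of the generators.\<close>

definition substitute ::
    "('g \<Rightarrow> ('h, 'k::field) ncpoly) \<Rightarrow> ('g, 'k) ncpoly \<Rightarrow> ('h, 'k) ncpoly" where
  "substitute h x =
    (\<Sum>u\<in>Poly_Mapping.keys x. scalar (Poly_Mapping.lookup x u) * prod_list (map h (letters u)))"

lemma substitute_superset:
  assumes "finite A" "Poly_Mapping.keys x \<subseteq> A"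
  shows "substitute h x =
    (\<Sum>u\<in>A. scalar (Poly_Mapping.lookup x u) * prod_list (map h (letters u)))"
  unfolding substitute_def
  by (rule sum.mono_neutral_left) (use assms in \<open>auto simp: in_keys_iff\<close>)

lemma substitute_0 [simp]: "substitute h 0 = 0"
  by (simp add: substitute_def)

lemma substitute_1 [simp]: "substitute h 1 = 1"
  by (simp add: substitute_def) (simp add: zero_word_def)

lemma substitute_add: "substitute h (x + y) = substitute h x + substitute h y"
proof -
  let ?A = "Poly_Mapping.keys x \<union> Poly_Mapping.keys y"
  have "Poly_Mapping.keys (x + y) \<subseteq> ?A"
    by (rule keys_add)
  then show ?thesis
    by (simp add: substitute_superset[of ?A] lookup_add scalar_add distrib_right sum.distrib)
qed

lemma substitute_diff: "substitute h (x - y) = substitute h x - substitute h y"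
  by (metis substitute_add add_diff_cancel_right' diff_add_cancel)

lemma substitute_sum: "substitute h (sum f I) = (\<Sum>i\<in>I. substitute h (f i))"
  by (induction I rule: infinite_finite_induct) (simp_all add: substitute_add)

lemma substitute_single:
  "substitute h (Poly_Mapping.single u c) = scalar c * prod_list (map h (letters u))"
  by (simp add: substitute_def)

lemma substitute_gen [simp]: "substitute h (gen g) = h g"
  by (simp add: gen_def substitute_single)

text \<open>By additivity in both arguments only monomials remain. There the coefficient of the
  second one is moved past the image of the first by centrality of scalars.\<close>

lemma substitute_mult: "substitute h (x * y) = substitute h x * substitute h y"
proof (induction x rule: ncpoly_induct)
  case (single u c)
  show ?case
  proof (induction y rule: ncpoly_induct)
    case (single v d)
    have "scalar c * scalar d * prod_list (map h u) * prod_list (map h v) =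
        scalar c * (prod_list (map h u) * scalar d) * prod_list (map h v)"
      by (simp add: scalar_commute[of "prod_list (map h u)"] mult.assoc)
    then show ?case
      by (simp add: mult_single substitute_single plus_word_def scalar_mult mult.assoc)
  qed (simp_all add: substitute_add distrib_left)
qed (simp_all add: substitute_add distrib_right)

lemma substitute_scalar_mult: "substitute h (scalar k * x) = scalar k * substitute h x"
  by (simp add: substitute_mult scalar_def substitute_single zero_word_def)

lemma substitute_eq_self:
  assumes "x \<in> word_span W" "W \<subseteq> lists G" "\<And>g. g \<in> G \<Longrightarrow> h g = gen g"
  shows "substitute h x = x"
  using assms(1)
proof (induction rule: word_span_induct)
  case (single u c)
  then have "map h u = map gen u"
    using assms(2,3) by auto
  then have "scalar c * prod_list (map h u) = Poly_Mapping.single (Word u) c"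
    by (simp only: single_Word_conv)
  then show ?case
    by (simp only: substitute_single word.sel)
qed (simp_all add: substitute_add)

lemma substitute_substitute:
  "substitute h (substitute h' x) = substitute (\<lambda>g. substitute h (h' g)) x"
proof (induction x rule: ncpoly_induct)
  case (single u c)
  have "substitute h (prod_list (map h' u)) = prod_list (map (\<lambda>g. substitute h (h' g)) u)"
    by (induction u) (simp_all add: substitute_mult)
  then show ?case
    by (simp add: substitute_single substitute_scalar_mult)
qed (simp_all add: substitute_add)

lemma substitute_in_word_span:
  assumes "x \<in> word_span W"
    and "\<And>u. u \<in> W \<Longrightarrow> prod_list (map h u) \<in> word_span W'"
  shows "substitute h x \<in> word_span W'"
  using assms(1)
  by (induction rule: word_span_induct)
     (simp_all add: assms(2) substitute_single substitute_add scalar_mult_in_word_span word_span_add)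

section \<open>The free algebra and the Leavitt ideal\<close>

lemma free_algebra_simps [simp]:
  "mult (free_algebra G) = (*)" "add (free_algebra G) = (+)"
  "zero (free_algebra G) = 0" "one (free_algebra G) = 1"
  by (simp_all add: free_algebra_def)

lemma free_algebra_mult_closed:
  "x \<in> word_span (lists G) \<Longrightarrow> y \<in> word_span (lists G) \<Longrightarrow> x * y \<in> word_span (lists G)"
  by (erule (1) word_span_mult) auto

lemma ring_free_algebra: "ring (free_algebra G :: ('g, 'k::field) ncpoly ring)"
proof (rule ringI)
  show "abelian_group (free_algebra G :: ('g, 'k) ncpoly ring)"
  proof (rule abelian_groupI)
    fix x :: "('g, 'k) ncpoly"
    assume "x \<in> carrier (free_algebra G)"
    then show "\<exists>y\<in>carrier (free_algebra G). y \<oplus>\<^bsub>free_algebra G\<^esub> x = \<zero>\<^bsub>free_algebra G\<^esub>"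
      by (intro bexI[of _ "- x"]) (simp_all add: carrier_free_algebra word_span_uminus)
  qed (simp_all add: carrier_free_algebra word_span_add add_ac)
  show "Group.monoid (free_algebra G :: ('g, 'k) ncpoly ring)"
    by (rule monoidI)
       (auto simp: carrier_free_algebra free_algebra_mult_closed one_in_word_span mult.assoc)
qed (simp_all add: distrib_left distrib_right)

text \<open>The free non-unital algebra on \<open>G\<close>. As a word span it inherits its closure
  properties directly; \<open>nonconst_eq\<close> links it to the vanishing constant coefficient in
  the carrier of \<open>leavitt_path_algebra\<close>.\<close>

definition nonconst :: "'g set \<Rightarrow> ('g, 'k::field) ncpoly set" where
  "nonconst G = word_span (lists G - {[]})"

lemma nonconst_add: "x \<in> nonconst G \<Longrightarrow> y \<in> nonconst G \<Longrightarrow> x + y \<in> nonconst G"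
  by (simp add: nonconst_def word_span_add)

lemma nonconst_diff: "x \<in> nonconst G \<Longrightarrow> y \<in> nonconst G \<Longrightarrow> x - y \<in> nonconst G"
  by (simp add: nonconst_def word_span_diff)

lemma nonconst_uminus: "x \<in> nonconst G \<Longrightarrow> - x \<in> nonconst G"
  by (simp add: nonconst_def word_span_uminus)

lemma zero_in_nonconst [simp]: "0 \<in> nonconst G"
  by (simp add: nonconst_def)

lemma nonconst_mult: "x \<in> nonconst G \<Longrightarrow> y \<in> nonconst G \<Longrightarrow> x * y \<in> nonconst G"
  unfolding nonconst_def by (erule (1) word_span_mult) auto

lemma nonconst_scalar_mult: "x \<in> nonconst G \<Longrightarrow> scalar k * x \<in> nonconst G"
  by (simp add: nonconst_def scalar_mult_in_word_span)

lemma gen_in_nonconst: "g \<in> G \<Longrightarrow> gen g \<in> nonconst G"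
  by (simp add: nonconst_def gen_in_word_span)

lemma nonconst_sum: "(\<And>i. i \<in> I \<Longrightarrow> f i \<in> nonconst G) \<Longrightarrow> sum f I \<in> nonconst G"
  by (simp add: nonconst_def word_span_sum)

lemmas nonconst_intros =
  nonconst_add nonconst_diff nonconst_mult gen_in_nonconst nonconst_sum

lemma nonconst_mono: "H \<subseteq> G \<Longrightarrow> nonconst H \<subseteq> nonconst G"
  unfolding nonconst_def by (rule word_span_mono) auto

lemma nonconst_subset_carrier: "nonconst G \<subseteq> carrier (free_algebra G)"
  unfolding nonconst_def carrier_free_algebra by (rule word_span_mono) auto

lemma nonconst_eq:
  fixes G :: "'g set"
  shows "nonconst G =
    {x \<in> carrier (free_algebra G :: ('g, 'k::field) ncpoly ring). Poly_Mapping.lookup x 0 = 0}"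
proof -
  have "x \<in> nonconst G \<longleftrightarrow>
      x \<in> carrier (free_algebra G) \<and> Word [] \<notin> Poly_Mapping.keys x" for x :: "('g, 'k::field) ncpoly"
    by (auto simp: nonconst_def carrier_free_algebra word_span_def) (metis word.collapse)
  then show ?thesis
    by (auto simp: in_keys_iff zero_word_def)
qed

lemma substitute_nonconst:
  assumes "x \<in> nonconst G" and h: "\<And>g. g \<in> G \<Longrightarrow> h g \<in> nonconst H"
  shows "substitute h x \<in> nonconst H"
proof -
  \<comment> \<open>The one-letter word is the effective base case, because the empty product is 1
    and has a constant term.\<close>
  have "prod_list (map h u) \<in> nonconst H" if "u \<in> lists G" "u \<noteq> []" for u
    using that
  proof (induction u)
    case (Cons g u)
    then show ?case
      by (cases "u = []") (auto intro: nonconst_mult h)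
  qed simp
  then show ?thesis
    using assms(1) unfolding nonconst_def by (auto elim!: substitute_in_word_span)
qed

lemma substitute_carrier:
  assumes "x \<in> carrier (free_algebra G)" and h: "\<And>g. g \<in> G \<Longrightarrow> h g \<in> carrier (free_algebra H)"
  shows "substitute h x \<in> carrier (free_algebra H)"
proof -
  have "prod_list (map h u) \<in> word_span (lists H)" if "u \<in> lists G" for u
    using that h unfolding carrier_free_algebra
    by (induction u) (auto intro: free_algebra_mult_closed one_in_word_span)
  then show ?thesis
    using assms(1) unfolding carrier_free_algebra by (auto elim!: substitute_in_word_span)
qed

lemma gen_lpa_nonconst [simp]:
  "v \<in> verts E \<Longrightarrow> gen (Vertex v) \<in> nonconst (lpa_gens E)"
  "e \<in> arcs E \<Longrightarrow> gen (Edge e) \<in> nonconst (lpa_gens E)"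
  "e \<in> arcs E \<Longrightarrow> gen (Ghost e) \<in> nonconst (lpa_gens E)"
  by (auto intro!: gen_in_nonconst simp: lpa_gens_def)

section \<open>The Leavitt ideal and the substitutions that preserve it\<close>

context wf_digraph
begin

text \<open>Well-formedness places tails and heads among the vertices, so every relator is built
  from symbols in \<open>lpa_gens G\<close> only.\<close>

lemma lpa_relators_nonconst: "lpa_relators G \<subseteq> nonconst (lpa_gens G)"
  by (auto simp: lpa_relators_def regular_vertex_def lpa_gens_def intro!: nonconst_intros)

lemma ideal_lpa_ideal: "ideal (lpa_ideal G) (free_algebra (lpa_gens G))"
  unfolding lpa_ideal_def
  using ring.genideal_ideal[OF ring_free_algebra] lpa_relators_nonconst nonconst_subset_carrier
  by blast

lemma relator_in_lpa_ideal: "r \<in> lpa_relators G \<Longrightarrow> r \<in> lpa_ideal G"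
  unfolding lpa_ideal_def
  using ring.genideal_self[OF ring_free_algebra] lpa_relators_nonconst nonconst_subset_carrier
  by blast

lemma lpa_ideal_0 [simp]: "0 \<in> lpa_ideal G"
  using additive_subgroup.zero_closed[OF ideal.axioms(1)[OF ideal_lpa_ideal]] by simp

lemma lpa_ideal_add: "a \<in> lpa_ideal G \<Longrightarrow> b \<in> lpa_ideal G \<Longrightarrow> a + b \<in> lpa_ideal G"
  using additive_subgroup.a_closed[OF ideal.axioms(1)[OF ideal_lpa_ideal]] by simp

lemma lpa_ideal_mult_left:
  "x \<in> carrier (free_algebra (lpa_gens G)) \<Longrightarrow> a \<in> lpa_ideal G \<Longrightarrow> x * a \<in> lpa_ideal G"
  using ideal.I_l_closed[OF ideal_lpa_ideal, of a x] by simp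

lemma lpa_ideal_mult_right:
  "x \<in> carrier (free_algebra (lpa_gens G)) \<Longrightarrow> a \<in> lpa_ideal G \<Longrightarrow> a * x \<in> lpa_ideal G"
  using ideal.I_r_closed[OF ideal_lpa_ideal, of a x] by simp

lemma lpa_ideal_scalar_mult: "a \<in> lpa_ideal G \<Longrightarrow> scalar k * a \<in> lpa_ideal G"
  by (rule lpa_ideal_mult_left)
     (simp_all add: carrier_free_algebra scalar_def single_in_word_span zero_word_def)

lemma lpa_ideal_uminus: "a \<in> lpa_ideal G \<Longrightarrow> - a \<in> lpa_ideal G"
  using lpa_ideal_mult_left[of "- 1" a]
  by (simp add: carrier_free_algebra word_span_uminus one_in_word_span)

lemma lpa_ideal_diff: "a \<in> lpa_ideal G \<Longrightarrow> b \<in> lpa_ideal G \<Longrightarrow> a - b \<in> lpa_ideal G"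
  using lpa_ideal_add[of a "- b"] lpa_ideal_uminus[of b] by simp

text \<open>The preimage of an ideal under a homomorphism is an ideal. Here it contains the
  relators, hence also the ideal that they generate.\<close>

lemma substitute_lpa_ideal:
  fixes h :: "('a, 'b) lpa_gen \<Rightarrow> (('a, 'b) lpa_gen, 'k::field) ncpoly"
  assumes h: "\<And>g. g \<in> lpa_gens G \<Longrightarrow> h g \<in> carrier (free_algebra (lpa_gens G))"
    and rel: "\<And>r. r \<in> lpa_relators G \<Longrightarrow> substitute h r \<in> lpa_ideal G"
    and a: "a \<in> lpa_ideal G"
  shows "substitute h a \<in> lpa_ideal G"
proof -
  let ?F = "free_algebra (lpa_gens G) :: (('a, 'b) lpa_gen, 'k) ncpoly ring"
  let ?J = "{x \<in> carrier ?F. substitute h x \<in> lpa_ideal G}"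
  interpret F: ring ?F
    by (rule ring_free_algebra)
  have uminus: "\<ominus>\<^bsub>?F\<^esub> x = - x" if "x \<in> carrier ?F" for x
    using that by (intro F.minus_equality) (simp_all add: carrier_free_algebra word_span_uminus)
  have "ideal ?J ?F"
  proof (rule idealI)
    have "- x \<in> ?J" if "x \<in> ?J" for x
      using that lpa_ideal_uminus[of "substitute h x"] substitute_diff[of h 0 x]
      by (simp add: carrier_free_algebra word_span_uminus)
    then show "subgroup ?J (add_monoid ?F)"
      by (intro F.add.subgroupI)
         (auto simp: uminus substitute_add lpa_ideal_add carrier_free_algebra word_span_add
           simp flip: a_inv_def intro: exI[of _ 0])
    fix a x
    assume "a \<in> ?J" and x: "x \<in> carrier ?F"
    moreover from x h have "substitute h x \<in> carrier ?F"
      by (rule substitute_carrier)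
    ultimately show "x \<otimes>\<^bsub>?F\<^esub> a \<in> ?J" "a \<otimes>\<^bsub>?F\<^esub> x \<in> ?J"
      using F.m_closed[of x a] F.m_closed[of a x]
      by (simp_all add: substitute_mult lpa_ideal_mult_left lpa_ideal_mult_right)
  qed (rule ring_free_algebra)
  then have "lpa_ideal G \<subseteq> ?J"
    unfolding lpa_ideal_def using lpa_relators_nonconst nonconst_subset_carrier rel
    by (intro F.genideal_minimal) (auto simp: lpa_ideal_def)
  then show ?thesis
    using a by blast
qed

section \<open>Operations on classes\<close>

lemma lpa_class_eq_iff:
  fixes x y :: "(('a, 'b) lpa_gen, 'k::field) ncpoly"
  shows "lpa_class G x = lpa_class G y \<longleftrightarrow> x - y \<in> lpa_ideal G"
proof -
  have class_conv: "lpa_class G x = {i + x | i. i \<in> lpa_ideal G}"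
    for x :: "(('a, 'b) lpa_gen, 'k) ncpoly"
    by (auto simp: lpa_class_def a_r_coset_def')
  have subset: "lpa_class G x \<subseteq> lpa_class G y" if "x - y \<in> lpa_ideal G"
    for x y :: "(('a, 'b) lpa_gen, 'k) ncpoly"
  proof
    fix z
    assume "z \<in> lpa_class G x"
    then obtain i where "i \<in> lpa_ideal G" "z = (i + (x - y)) + y"
      by (auto simp: class_conv)
    moreover from this that have "i + (x - y) \<in> lpa_ideal G"
      by (intro lpa_ideal_add)
    ultimately show "z \<in> lpa_class G y"
      unfolding class_conv by blast
  qed
  show ?thesis
  proof
    assume "lpa_class G x = lpa_class G y"
    moreover have "x \<in> lpa_class G x"
      by (auto simp: class_conv)
    ultimately show "x - y \<in> lpa_ideal G"
      by (auto simp: class_conv)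
  next
    assume "x - y \<in> lpa_ideal G"
    with lpa_ideal_uminus[OF this] show "lpa_class G x = lpa_class G y"
      by (intro equalityI subset) simp_all
  qed
qed

lemma carrier_lpa: "carrier (leavitt_path_algebra G) = lpa_class G ` nonconst (lpa_gens G)"
  by (simp add: leavitt_path_algebra_def Let_def nonconst_eq)

lemma lpa_class_carrier:
  "x \<in> nonconst (lpa_gens G) \<Longrightarrow> lpa_class G x \<in> carrier (leavitt_path_algebra G)"
  by (simp add: carrier_lpa)

lemma lpa_zero: "\<zero>\<^bsub>leavitt_path_algebra G\<^esub> = lpa_class G 0"
  by (auto simp: leavitt_path_algebra_def Let_def FactRing_def lpa_class_def a_r_coset_def')

lemma lpa_one: "\<one>\<^bsub>leavitt_path_algebra G\<^esub> = lpa_class G (\<Sum>v\<in>verts G. gen (Vertex v))"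
  by (simp add: leavitt_path_algebra_def Let_def)

lemma lpa_add:
  assumes "x \<in> nonconst (lpa_gens G)" "y \<in> nonconst (lpa_gens G)"
  shows "lpa_class G x \<oplus>\<^bsub>leavitt_path_algebra G\<^esub> lpa_class G y = lpa_class G (x + y)"
  using ideal.a_rcos_sum[OF ideal_lpa_ideal, of x y] assms nonconst_subset_carrier
  by (auto simp: leavitt_path_algebra_def Let_def FactRing_def lpa_class_def)

lemma lpa_mult:
  assumes "x \<in> nonconst (lpa_gens G)" "y \<in> nonconst (lpa_gens G)"
  shows "lpa_class G x \<otimes>\<^bsub>leavitt_path_algebra G\<^esub> lpa_class G y = lpa_class G (x * y)"
  using ideal.rcoset_mult_add[OF ideal_lpa_ideal, of x y] assms nonconst_subset_carrier
  by (auto simp: leavitt_path_algebra_def Let_def FactRing_def lpa_class_def)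

text \<open>Evaluates maps on classes that are defined as unions over all representatives, such as
  scalar multiplication. If \<open>f\<close> respects congruence, all the classes in the union
  coincide.\<close>

lemma Union_lpa_class:
  assumes "\<And>a. a \<in> lpa_ideal G \<Longrightarrow> f (a + x) - f x \<in> lpa_ideal G"
  shows "(\<Union>y\<in>lpa_class G x. lpa_class G (f y)) = lpa_class G (f x)"
proof -
  have "lpa_class G (f y) = lpa_class G (f x)" if "y \<in> lpa_class G x" for y
    using that assms by (auto simp: lpa_class_eq_iff) (auto simp: lpa_class_def a_r_coset_def')
  moreover have "x \<in> lpa_class G x"
    by (auto simp: lpa_class_def a_r_coset_def' intro!: bexI[of _ 0])
  ultimately show ?thesis
    by blast
qed

lemma lpa_smult: "k \<odot>\<^bsub>leavitt_path_algebra G\<^esub> lpa_class G x = lpa_class G (scalar k * x)"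
  using Union_lpa_class[of "(*) (scalar k)" x]
  by (simp add: leavitt_path_algebra_def Let_def distrib_left lpa_ideal_scalar_mult)

text \<open>Supplies the uniqueness of additive inverses, by which subtraction of classes is
  computed in \<open>lpa_minus\<close>.\<close>

lemma abelian_group_lpa: "abelian_group (leavitt_path_algebra G)"
proof (rule abelian_groupI)
  fix x
  assume "x \<in> carrier (leavitt_path_algebra G)"
  then obtain a where "a \<in> nonconst (lpa_gens G)" "x = lpa_class G a"
    by (auto simp: carrier_lpa)
  then show "\<exists>y\<in>carrier (leavitt_path_algebra G). y \<oplus>\<^bsub>leavitt_path_algebra G\<^esub> x =
      \<zero>\<^bsub>leavitt_path_algebra G\<^esub>"
    by (intro bexI[of _ "lpa_class G (- a)"])
       (simp_all add: lpa_add lpa_zero nonconst_uminus lpa_class_carrier)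
qed (auto simp: carrier_lpa lpa_add lpa_zero nonconst_add add_ac)

lemma lpa_minus:
  assumes x: "x \<in> nonconst (lpa_gens G)" and y: "y \<in> nonconst (lpa_gens G)"
  shows "lpa_class G x \<ominus>\<^bsub>leavitt_path_algebra G\<^esub> lpa_class G y = lpa_class G (x - y)"
proof -
  have "\<ominus>\<^bsub>leavitt_path_algebra G\<^esub> lpa_class G y = lpa_class G (- y)"
    by (rule abelian_group.minus_equality[OF abelian_group_lpa])
       (simp_all add: y lpa_add lpa_zero nonconst_uminus lpa_class_carrier)
  then show ?thesis
    by (simp add: a_minus_def lpa_add x y nonconst_uminus)
qed

section \<open>Subalgebras of Leavitt path algebras\<close>

text \<open>The image of the free non-unital algebra on \<open>H\<close> under the quotient map. It
  serves to find representatives that use only chosen generators.\<close>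

lemma is_subalgebra_nonconst_image:
  assumes "H \<subseteq> lpa_gens G"
  shows "is_subalgebra (leavitt_path_algebra G) (lpa_class G ` nonconst H)"
proof -
  have sub: "x \<in> nonconst (lpa_gens G)" if "x \<in> nonconst H" for x
    using that nonconst_mono[OF assms] by blast
  show ?thesis
    unfolding is_subalgebra_def
    by (auto simp: carrier_lpa lpa_zero lpa_add lpa_mult lpa_smult sub
        intro!: imageI nonconst_add nonconst_mult nonconst_scalar_mult)
qed

text \<open>Every element is a linear combination of classes of nonempty words, and such a class is
  a product of classes of generators.\<close>

lemma lpa_generated_by_gens:
  fixes B :: "('a, 'b, 'k::field) lpa_elem set"
  assumes B: "is_subalgebra (leavitt_path_algebra G) B"
    and gens: "\<And>g. g \<in> lpa_gens G \<Longrightarrow> lpa_class G (gen g) \<in> B"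
  shows "carrier (leavitt_path_algebra G) \<subseteq> B"
proof -
  \<comment> \<open>Both claims are proved together because \<open>lpa_mult\<close> computes
    products only for polynomials known to lie in \<open>nonconst\<close>. The empty word is
    excluded: the class of the polynomial 1 need not lie in \<open>B\<close>.\<close>
  have word: "(prod_list (map gen u) :: (_, 'k) ncpoly) \<in> nonconst (lpa_gens G) \<and>
      lpa_class G (prod_list (map gen u)) \<in> B"
    if "u \<in> lists (lpa_gens G)" "u \<noteq> []" for u
    using that
  proof (induction u)
    case (Cons g u)
    show ?case
    proof (cases "u = []")
      case False
      with Cons have u: "(prod_list (map gen u) :: (_, 'k) ncpoly) \<in> nonconst (lpa_gens G)"
        "lpa_class G (prod_list (map gen u)) \<in> B" and g: "g \<in> lpa_gens G"
        by auto
      have "lpa_class G (gen g) \<otimes>\<^bsub>leavitt_path_algebra G\<^esub> lpa_class G (prod_list (map gen u)) \<in> B"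
        using B gens[OF g] u(2) by (simp add: is_subalgebra_def)
      then show ?thesis
        using g u(1) by (simp add: lpa_mult gen_in_nonconst nonconst_mult)
    qed (use Cons gens in \<open>auto intro: gen_in_nonconst\<close>)
  qed simp
  have "x \<in> nonconst (lpa_gens G) \<and> lpa_class G x \<in> B"
    if "x \<in> word_span (lists (lpa_gens G) - {[]})" for x
    using that
  proof (induction rule: word_span_induct)
    case zero
    then show ?case
      using B by (simp add: is_subalgebra_def lpa_zero)
  next
    case (single u c)
    then have "c \<odot>\<^bsub>leavitt_path_algebra G\<^esub> lpa_class G (prod_list (map gen u)) \<in> B"
      using B word[of u] by (simp add: is_subalgebra_def)
    then show ?case
      using single word[of u] by (simp add: lpa_smult single_Word_conv nonconst_scalar_mult)
  next
    case (add x y)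
    then have "lpa_class G x \<oplus>\<^bsub>leavitt_path_algebra G\<^esub> lpa_class G y \<in> B"
      using B by (simp add: is_subalgebra_def)
    with add show ?case
      by (simp add: lpa_add nonconst_add)
  qed
  then show ?thesis
    by (auto simp: carrier_lpa nonconst_def)
qed

lemma is_subalgebra_equalizer:
  fixes \<sigma> \<tau> :: "('a, 'b, 'k::field) lpa_elem \<Rightarrow> ('a, 'b, 'k) lpa_elem"
  assumes \<sigma>: "\<sigma> \<in> algebra_auto (leavitt_path_algebra G)"
    and \<tau>: "\<tau> \<in> algebra_auto (leavitt_path_algebra G)"
  shows "is_subalgebra (leavitt_path_algebra G)
    {x \<in> carrier (leavitt_path_algebra G). \<sigma> x = \<tau> x}"
proof -
  let ?L = "leavitt_path_algebra G :: ('k, ('a, 'b, 'k) lpa_elem) module"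
  have iso: "\<sigma> \<in> ring_iso ?L ?L" "\<tau> \<in> ring_iso ?L ?L"
    using \<sigma> \<tau> by (simp_all add: algebra_auto_def)
  have smult: "\<sigma> (k \<odot>\<^bsub>?L\<^esub> x) = k \<odot>\<^bsub>?L\<^esub> \<sigma> x" "\<tau> (k \<odot>\<^bsub>?L\<^esub> x) = k \<odot>\<^bsub>?L\<^esub> \<tau> x"
    if "x \<in> carrier ?L" for k x
    using \<sigma> \<tau> that by (simp_all add: algebra_auto_def)
  have sub: "is_subalgebra ?L (carrier ?L)"
    using is_subalgebra_nonconst_image[of "lpa_gens G"] by (simp add: carrier_lpa)
  then have zero: "\<zero>\<^bsub>?L\<^esub> \<in> carrier ?L"
    by (simp add: is_subalgebra_def)
  have smult_0: "0 \<odot>\<^bsub>?L\<^esub> x = \<zero>\<^bsub>?L\<^esub>" if "x \<in> carrier ?L" for x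
    using that by (auto simp: carrier_lpa lpa_smult lpa_zero)
  \<comment> \<open>Preservation of zero comes from linearity: the image of zero is the image of 0
    times zero, hence 0 times an element of the carrier.\<close>
  have "\<sigma> \<zero>\<^bsub>?L\<^esub> = \<zero>\<^bsub>?L\<^esub>" "\<tau> \<zero>\<^bsub>?L\<^esub> = \<zero>\<^bsub>?L\<^esub>"
    using smult[OF zero, of 0] iso[THEN ring_iso_memE(1), OF zero] by (simp_all add: smult_0 zero)
  then show ?thesis
    using sub iso[THEN ring_iso_memE(2)] iso[THEN ring_iso_memE(3)] smult
    unfolding is_subalgebra_def by auto
qed

text \<open>The equalizer is a subalgebra containing the generators, so it is everything. Outside
  the carrier the two maps agree by extensionality.\<close>

lemma algebra_auto_eqI:
  assumes "\<sigma> \<in> algebra_auto (leavitt_path_algebra G)"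
    and "\<tau> \<in> algebra_auto (leavitt_path_algebra G)"
    and "\<And>g. g \<in> lpa_gens G \<Longrightarrow> \<sigma> (lpa_class G (gen g)) = \<tau> (lpa_class G (gen g))"
  shows "\<sigma> = \<tau>"
proof -
  have "carrier (leavitt_path_algebra G) \<subseteq>
      {x \<in> carrier (leavitt_path_algebra G). \<sigma> x = \<tau> x}"
    using assms by (intro lpa_generated_by_gens is_subalgebra_equalizer)
      (auto intro: lpa_class_carrier gen_in_nonconst)
  then show ?thesis
    using assms(1,2) by (auto simp: algebra_auto_def intro!: extensionalityI)
qed

section \<open>Automorphisms induced by substitutions\<close>

text \<open>Two substitutions that preserve the ideal and are mutually inverse on generators descend
  to mutually inverse maps of the quotient. Fixing the vertices makes the identity, their sum, fixed
  as well.\<close>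

lemma algebra_auto_of_substitutions:
  fixes h h' :: "('a, 'b) lpa_gen \<Rightarrow> (('a, 'b) lpa_gen, 'k::field) ncpoly"
  defines "L \<equiv> leavitt_path_algebra G :: ('k, ('a, 'b, 'k) lpa_elem) module"
  assumes h: "\<And>g. g \<in> lpa_gens G \<Longrightarrow> h g \<in> nonconst (lpa_gens G)"
    and h': "\<And>g. g \<in> lpa_gens G \<Longrightarrow> h' g \<in> nonconst (lpa_gens G)"
    and rel: "\<And>r. r \<in> lpa_relators G \<Longrightarrow> substitute h r \<in> lpa_ideal G"
    and rel': "\<And>r. r \<in> lpa_relators G \<Longrightarrow> substitute h' r \<in> lpa_ideal G"
    and hh': "\<And>g. g \<in> lpa_gens G \<Longrightarrow> substitute h (h' g) = gen g"
    and h'h: "\<And>g. g \<in> lpa_gens G \<Longrightarrow> substitute h' (h g) = gen g"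
    and vertex: "\<And>v. h (Vertex v) = gen (Vertex v)"
  obtains \<sigma> where "\<sigma> \<in> algebra_auto L"
    and "\<And>x. x \<in> nonconst (lpa_gens G) \<Longrightarrow> \<sigma> (lpa_class G x) = lpa_class G (substitute h x)"
    and "\<And>x. x \<in> nonconst (lpa_gens G) \<Longrightarrow>
      inv_into (carrier L) \<sigma> (lpa_class G x) = lpa_class G (substitute h' x)"
proof -
  let ?N = "nonconst (lpa_gens G)"
  \<comment> \<open>Taking the union over all representatives avoids a choice;
    \<open>restrict\<close> provides the extensionality required by
    \<open>algebra_auto\<close>.\<close>
  define \<sigma> where "\<sigma> = restrict (\<lambda>X. \<Union>x\<in>X. lpa_class G (substitute h x)) (carrier L)"
  have closed: "substitute h x \<in> ?N" "substitute h' x \<in> ?N" if "x \<in> ?N" for x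
    using that h h' by (auto intro: substitute_nonconst)
  have ideal: "substitute h a \<in> lpa_ideal G" "substitute h' a \<in> lpa_ideal G"
    if "a \<in> lpa_ideal G" for a
    using that h h' rel rel' nonconst_subset_carrier by (blast intro: substitute_lpa_ideal)+
  have inverse: "substitute h (substitute h' x) = x" "substitute h' (substitute h x) = x"
    if "x \<in> ?N" for x
    unfolding substitute_substitute
    using that hh' h'h unfolding nonconst_def by (auto intro: substitute_eq_self)
  have \<sigma>: "\<sigma> (lpa_class G x) = lpa_class G (substitute h x)" if "x \<in> ?N" for x
    using that Union_lpa_class[of "substitute h" x]
    by (simp add: \<sigma>_def L_def lpa_class_carrier substitute_add ideal)
  have inj: "inj_on \<sigma> (carrier L)"
  proof (rule inj_onI)
    fix X Y
    assume "X \<in> carrier L" "Y \<in> carrier L" and eq: "\<sigma> X = \<sigma> Y"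
    then obtain x y where xy: "x \<in> ?N" "y \<in> ?N" "X = lpa_class G x" "Y = lpa_class G y"
      by (auto simp: L_def carrier_lpa)
    with eq have "substitute h (x - y) \<in> lpa_ideal G"
      by (simp add: \<sigma> lpa_class_eq_iff substitute_diff)
    \<comment> \<open>The inverse substitution recovers \<open>x - y\<close> and keeps it in the
      ideal, which gives injectivity.\<close>
    then have "substitute h' (substitute h (x - y)) \<in> lpa_ideal G"
      by (rule ideal)
    then show "X = Y"
      using xy by (simp add: inverse nonconst_diff lpa_class_eq_iff)
  qed
  have surj: "\<sigma> ` carrier L = carrier L"
  proof -
    have "\<sigma> ` carrier L = lpa_class G ` substitute h ` ?N"
      by (simp add: L_def carrier_lpa image_image \<sigma>)
    \<comment> \<open>Each \<open>x\<close> is the image of \<open>substitute h' x\<close>.\<close>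
    also have "substitute h ` ?N = ?N"
      using closed inverse by force
    finally show ?thesis
      by (simp add: L_def carrier_lpa)
  qed
  have "\<sigma> \<in> ring_hom L L"
  proof (rule ring_hom_memI)
    have "(\<Sum>v\<in>verts G. gen (Vertex v)) \<in> (?N :: (_, 'k) ncpoly set)"
      by (intro nonconst_sum) simp
    then show "\<sigma> \<one>\<^bsub>L\<^esub> = \<one>\<^bsub>L\<^esub>"
      by (simp add: L_def lpa_one \<sigma> substitute_sum vertex)
  qed (auto simp: L_def carrier_lpa \<sigma> closed lpa_add lpa_mult nonconst_add nonconst_mult
      substitute_add substitute_mult)
  moreover have "\<sigma> (k \<odot>\<^bsub>L\<^esub> X) = k \<odot>\<^bsub>L\<^esub> \<sigma> X" if "X \<in> carrier L" for k X
    using that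
    by (auto simp: L_def carrier_lpa \<sigma> lpa_smult nonconst_scalar_mult substitute_scalar_mult)
  ultimately have "\<sigma> \<in> algebra_auto L"
    using inj surj by (simp add: algebra_auto_def ring_iso_def bij_betw_def \<sigma>_def)
  moreover have "inv_into (carrier L) \<sigma> (lpa_class G x) = lpa_class G (substitute h' x)"
    if "x \<in> ?N" for x
    using that inj
    by (intro inv_into_f_eq) (simp_all add: \<sigma> closed inverse lpa_class_carrier L_def)
  ultimately show thesis
    using that \<sigma> by blast
qed

section \<open>The shear along two parallel edges\<close>

lemma lpa_ideal_relations:
  assumes "e \<in> arcs G"
  shows "gen (Vertex (tail G e)) * gen (Edge e) - gen (Edge e) \<in> lpa_ideal G"
    and "gen (Edge e) * gen (Vertex (head G e)) - gen (Edge e) \<in> lpa_ideal G"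
    and "gen (Ghost e) * gen (Vertex (tail G e)) - gen (Ghost e) \<in> lpa_ideal G"
    and "gen (Vertex (head G e)) * gen (Ghost e) - gen (Ghost e) \<in> lpa_ideal G"
    and "gen (Ghost e) * gen (Edge e) - gen (Vertex (head G e)) \<in> lpa_ideal G"
    and "f \<in> arcs G \<Longrightarrow> e \<noteq> f \<Longrightarrow> gen (Ghost e) * gen (Edge f) \<in> lpa_ideal G"
  using assms by (auto intro!: relator_in_lpa_ideal simp: lpa_relators_def) metis+

end

text \<open>An elementary transvection: the row \<open>(e\<^sub>1, e\<^sub>2)\<close> is multiplied
  on the right by the unipotent matrix with rows (1, P) and (0, 1), and the column of the two ghost
  edges on the left by its inverse.\<close>

definition edge_shear ::
    "'e \<Rightarrow> 'e \<Rightarrow> (('v, 'e) lpa_gen, 'k) ncpoly \<Rightarrow> ('v, 'e) lpa_gen \<Rightarrow>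
      (('v, 'e) lpa_gen, 'k::field) ncpoly" where
  "edge_shear e\<^sub>1 e\<^sub>2 P g =
    (if g = Edge e\<^sub>2 then gen (Edge e\<^sub>2) + gen (Edge e\<^sub>1) * P
     else if g = Ghost e\<^sub>1 then gen (Ghost e\<^sub>1) - P * gen (Ghost e\<^sub>2)
     else gen g)"

text \<open>In each case the image of the relator is written as an explicit combination of relators
  and of the commutator of \<open>w\<close> and \<open>P\<close>, which lies in the ideal by
  \<open>comm\<close>.\<close>

lemma (in wf_digraph) substitute_edge_shear_relator:
  fixes P :: "(('a, 'b) lpa_gen, 'k::field) ncpoly"
  assumes arcs: "e\<^sub>1 \<in> arcs G" "e\<^sub>2 \<in> arcs G" "e\<^sub>1 \<noteq> e\<^sub>2"
    and tail: "tail G e\<^sub>1 = tail G e\<^sub>2" and head: "head G e\<^sub>1 = head G e\<^sub>2"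
    and P: "P \<in> nonconst (lpa_gens G)"
    and comm: "gen (Vertex (head G e\<^sub>2)) * P - P * gen (Vertex (head G e\<^sub>2)) \<in> lpa_ideal G"
    and r: "r \<in> lpa_relators G"
  shows "substitute (edge_shear e\<^sub>1 e\<^sub>2 P) r \<in> lpa_ideal G"
proof -
  let ?E\<^sub>1 = "gen (Edge e\<^sub>1) :: (('a, 'b) lpa_gen, 'k) ncpoly"
    and ?E\<^sub>2 = "gen (Edge e\<^sub>2) :: (('a, 'b) lpa_gen, 'k) ncpoly"
    and ?S\<^sub>1 = "gen (Ghost e\<^sub>1) :: (('a, 'b) lpa_gen, 'k) ncpoly"
    and ?S\<^sub>2 = "gen (Ghost e\<^sub>2) :: (('a, 'b) lpa_gen, 'k) ncpoly"
    and ?W = "gen (Vertex (head G e\<^sub>2)) :: (('a, 'b) lpa_gen, 'k) ncpoly"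
  let ?s = "substitute (edge_shear e\<^sub>1 e\<^sub>2 P)"
  note shear = edge_shear_def substitute_mult substitute_diff
  have lmult: "x * a \<in> lpa_ideal G" and rmult: "a * x \<in> lpa_ideal G"
    if "a \<in> lpa_ideal G" "x \<in> nonconst (lpa_gens G)" for a x :: "(('a, 'b) lpa_gen, 'k) ncpoly"
    using that nonconst_subset_carrier by (blast intro: lpa_ideal_mult_left lpa_ideal_mult_right)+
  note ideal = lpa_ideal_add lpa_ideal_diff lmult rmult
  have N: "?E\<^sub>1 \<in> nonconst (lpa_gens G)" "?S\<^sub>2 \<in> nonconst (lpa_gens G)"
    using arcs by (simp_all add:)
  have comm: "?W * P - P * ?W \<in> lpa_ideal G"
    using comm by (simp add:)
  \<comment> \<open>The relations of both edges are expressed through the tail and head of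
    \<open>e\<^sub>2\<close>, so that they can be combined.\<close>
  note rel\<^sub>1 = lpa_ideal_relations[OF arcs(1), unfolded tail head]
  note rel\<^sub>2 = lpa_ideal_relations[OF arcs(2)]
  consider
    (vertices) v w where "v \<in> verts G" "w \<in> verts G"
      "r = gen (Vertex v) * gen (Vertex w) - (if v = w then gen (Vertex w) else 0)"
  | (tail_edge) e where "e \<in> arcs G" "r = gen (Vertex (tail G e)) * gen (Edge e) - gen (Edge e)"
  | (edge_head) e where "e \<in> arcs G" "r = gen (Edge e) * gen (Vertex (head G e)) - gen (Edge e)"
  | (ghost_tail) e where "e \<in> arcs G" "r = gen (Ghost e) * gen (Vertex (tail G e)) - gen (Ghost e)"
  | (head_ghost) e where "e \<in> arcs G" "r = gen (Vertex (head G e)) * gen (Ghost e) - gen (Ghost e)"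
  | (ghost_edge) e f where "e \<in> arcs G" "f \<in> arcs G"
      "r = gen (Ghost e) * gen (Edge f) - (if e = f then gen (Vertex (head G e)) else 0)"
  | (regular) v where "regular_vertex G v"
      "r = gen (Vertex v) - (\<Sum>e\<in>out_arcs G v. gen (Edge e) * gen (Ghost e))"
    using r unfolding lpa_relators_def by blast
  then show ?thesis
  proof cases
    case vertices
    then have "?s r = r"
      by (simp add: shear)
    with r show ?thesis
      by (simp add: relator_in_lpa_ideal)
  next
    case tail_edge
    show ?thesis
    proof (cases "e = e\<^sub>2")
      case True
      let ?V = "gen (Vertex (tail G e\<^sub>2)) :: (('a, 'b) lpa_gen, 'k) ncpoly"
      have "(?V * ?E\<^sub>2 - ?E\<^sub>2) + (?V * ?E\<^sub>1 - ?E\<^sub>1) * P \<in> lpa_ideal G"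
        by (simp only: ideal P rel\<^sub>1 rel\<^sub>2)
      also have "(?V * ?E\<^sub>2 - ?E\<^sub>2) + (?V * ?E\<^sub>1 - ?E\<^sub>1) * P = ?s r"
        unfolding tail_edge(2) using True by (simp add: shear algebra_simps)
      finally show ?thesis .
    next
      case False
      with tail_edge have "?s r = r"
        by (simp add: shear)
      with r show ?thesis
        by (simp add: relator_in_lpa_ideal)
    qed
  next
    case edge_head
    show ?thesis
    proof (cases "e = e\<^sub>2")
      case True
      \<comment> \<open>The commutator turns \<open>?E\<^sub>1 * P * ?W\<close> into
        \<open>?E\<^sub>1 * ?W * P\<close>, where the head of \<open>e\<^sub>1\<close> is
        absorbed.\<close>
      have "(?E\<^sub>2 * ?W - ?E\<^sub>2) - ?E\<^sub>1 * (?W * P - P * ?W) + (?E\<^sub>1 * ?W - ?E\<^sub>1) * P \<in> lpa_ideal G"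
        by (simp only: ideal P rel\<^sub>1 rel\<^sub>2 N comm)
      also have "(?E\<^sub>2 * ?W - ?E\<^sub>2) - ?E\<^sub>1 * (?W * P - P * ?W) + (?E\<^sub>1 * ?W - ?E\<^sub>1) * P = ?s r"
        unfolding edge_head(2) using True by (simp add: shear algebra_simps)
      finally show ?thesis .
    next
      case False
      with edge_head have "?s r = r"
        by (simp add: shear)
      with r show ?thesis
        by (simp add: relator_in_lpa_ideal)
    qed
  next
    case ghost_tail
    show ?thesis
    proof (cases "e = e\<^sub>1")
      case True
      let ?V = "gen (Vertex (tail G e\<^sub>2)) :: (('a, 'b) lpa_gen, 'k) ncpoly"
      have "(?S\<^sub>1 * ?V - ?S\<^sub>1) - P * (?S\<^sub>2 * ?V - ?S\<^sub>2) \<in> lpa_ideal G"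
        by (simp only: ideal P rel\<^sub>1 rel\<^sub>2)
      also have "(?S\<^sub>1 * ?V - ?S\<^sub>1) - P * (?S\<^sub>2 * ?V - ?S\<^sub>2) = ?s r"
        unfolding ghost_tail(2) using True tail by (simp add: shear algebra_simps)
      finally show ?thesis .
    next
      case False
      with ghost_tail have "?s r = r"
        by (simp add: shear)
      with r show ?thesis
        by (simp add: relator_in_lpa_ideal)
    qed
  next
    case head_ghost
    show ?thesis
    proof (cases "e = e\<^sub>1")
      case True
      \<comment> \<open>The mirror image of the previous use of the commutator: \<open>?W\<close> is
        moved past \<open>P\<close> and absorbed by \<open>?S\<^sub>2\<close>.\<close>
      have "(?W * ?S\<^sub>1 - ?S\<^sub>1) - (?W * P - P * ?W) * ?S\<^sub>2 - P * (?W * ?S\<^sub>2 - ?S\<^sub>2) \<in> lpa_ideal G"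
        by (simp only: ideal P rel\<^sub>1 rel\<^sub>2 N comm)
      also have "(?W * ?S\<^sub>1 - ?S\<^sub>1) - (?W * P - P * ?W) * ?S\<^sub>2 - P * (?W * ?S\<^sub>2 - ?S\<^sub>2) = ?s r"
        unfolding head_ghost(2) using True head by (simp add: shear algebra_simps)
      finally show ?thesis .
    next
      case False
      with head_ghost have "?s r = r"
        by (simp add: shear)
      with r show ?thesis
        by (simp add: relator_in_lpa_ideal)
    qed
  next
    case ghost_edge
    consider "e = e\<^sub>1" "f = e\<^sub>2" | "e = e\<^sub>1" "f \<noteq> e\<^sub>2" | "e \<noteq> e\<^sub>1" "f = e\<^sub>2" | "e \<noteq> e\<^sub>1" "f \<noteq> e\<^sub>2"
      by blast
    then show ?thesis
    proof cases
      case 1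
      \<comment> \<open>Of the four products in the expansion, the two mixed ones vanish modulo the
        ideal by orthogonality; the other two leave \<open>?W * P - P * ?W\<close>.\<close>
      have "?S\<^sub>1 * ?E\<^sub>2 + (?S\<^sub>1 * ?E\<^sub>1 - ?W) * P - P * (?S\<^sub>2 * ?E\<^sub>2 - ?W) - P * (?S\<^sub>2 * ?E\<^sub>1) * P
          + (?W * P - P * ?W) \<in> lpa_ideal G"
        by (simp only: ideal P rel\<^sub>1 rel\<^sub>2 comm
          lpa_ideal_relations(6)[OF arcs(1,2,3)]
          lpa_ideal_relations(6)[OF arcs(2,1) arcs(3)[symmetric]])
      also have "?S\<^sub>1 * ?E\<^sub>2 + (?S\<^sub>1 * ?E\<^sub>1 - ?W) * P - P * (?S\<^sub>2 * ?E\<^sub>2 - ?W) - P * (?S\<^sub>2 * ?E\<^sub>1) * P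
          + (?W * P - P * ?W) = ?s r"
        unfolding ghost_edge(3) using 1 arcs(3) by (simp add: shear algebra_simps)
      finally show ?thesis .
    next
      case 2
      then have "?S\<^sub>2 * gen (Edge f) \<in> lpa_ideal G"
        using ghost_edge arcs by (intro lpa_ideal_relations) auto
      then have "r - P * (?S\<^sub>2 * gen (Edge f)) \<in> lpa_ideal G"
        by (simp only: ideal P relator_in_lpa_ideal[OF r])
      also have "r - P * (?S\<^sub>2 * gen (Edge f)) = ?s r"
        unfolding ghost_edge(3) using 2 by (simp add: shear algebra_simps)
      finally show ?thesis .
    next
      case 3
      then have "gen (Ghost e) * ?E\<^sub>1 \<in> lpa_ideal G"
        using ghost_edge arcs by (intro lpa_ideal_relations) auto
      then have "r + (gen (Ghost e) * ?E\<^sub>1) * P \<in> lpa_ideal G"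
        by (simp only: ideal P relator_in_lpa_ideal[OF r])
      also have "r + (gen (Ghost e) * ?E\<^sub>1) * P = ?s r"
        unfolding ghost_edge(3) using 3 by (simp add: shear algebra_simps)
      finally show ?thesis .
    next
      case 4
      with ghost_edge have "?s r = r"
        by (simp add: shear)
      with r show ?thesis
        by (simp add: relator_in_lpa_ideal)
    qed
  next
    case regular
    let ?A = "out_arcs G v"
    have fin: "finite ?A"
      using regular by (simp add: regular_vertex_def)
    \<comment> \<open>The sum is fixed exactly, not only modulo the ideal. At the common tail both
      edges occur and their extra terms cancel; at any other vertex neither edge occurs.\<close>
    have "(\<Sum>e\<in>?A. ?s (gen (Edge e)) * ?s (gen (Ghost e))) =
        (\<Sum>e\<in>?A. gen (Edge e) * gen (Ghost e))"
    proof (cases "v = tail G e\<^sub>2")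
      case True
      then have "e\<^sub>1 \<in> ?A" "e\<^sub>2 \<in> ?A - {e\<^sub>1}"
        using arcs tail by auto
      then have split: "sum f ?A = f e\<^sub>1 + f e\<^sub>2 + sum f (?A - {e\<^sub>1} - {e\<^sub>2})"
        for f :: "'b \<Rightarrow> (('a, 'b) lpa_gen, 'k) ncpoly"
        using fin by (simp add: sum.remove[of ?A e\<^sub>1] sum.remove[of "?A - {e\<^sub>1}" e\<^sub>2] add.assoc)
      show ?thesis
        unfolding split using arcs(3) by (simp add: shear algebra_simps)
    next
      case False
      then show ?thesis
        using tail by (intro sum.cong) (auto simp: shear)
    qed
    then have "?s r = r"
      using regular by (simp add: substitute_diff substitute_sum substitute_mult)
        (simp add: shear)
    with r show ?thesis
      by (simp add: relator_in_lpa_ideal)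
  qed
qed

text \<open>The classes of polynomials avoiding \<open>Edge e\<^sub>2\<close> and
  \<open>Ghost e\<^sub>1\<close> form a subalgebra containing the prescribed generators, hence the
  subalgebra generated by them. The two avoided symbols are the ones that the shear moves.\<close>

lemma (in wf_digraph) two_edge_subalgebra_reps:
  fixes q :: "('a, 'b, 'k::field) lpa_elem"
  assumes "q \<in> lpa_two_edge_subalgebra G e\<^sub>1 e\<^sub>2"
  obtains x where "x \<in> nonconst (lpa_gens G - {Edge e\<^sub>2, Ghost e\<^sub>1})" "q = lpa_class G x"
proof -
  let ?B = "lpa_class G ` nonconst (lpa_gens G - {Edge e\<^sub>2, Ghost e\<^sub>1}) :: ('a, 'b, 'k) lpa_elem set"
  have "is_subalgebra (leavitt_path_algebra G) ?B"
    by (rule is_subalgebra_nonconst_image) blast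
  moreover have "lpa_vertex G ` verts G \<union> lpa_edge G ` (arcs G - {e\<^sub>2}) \<union>
      lpa_ghost G ` (arcs G - {e\<^sub>1}) \<subseteq> ?B"
    by (auto simp: lpa_vertex_def lpa_edge_def lpa_ghost_def lpa_gens_def
        intro!: imageI gen_in_nonconst)
  ultimately have "lpa_two_edge_subalgebra G e\<^sub>1 e\<^sub>2 \<subseteq> ?B"
    unfolding lpa_two_edge_subalgebra_def generated_subalgebra_def by blast
  with assms that show thesis
    by blast
qed

lemma substitute_edge_shear_eq_self:
  assumes "x \<in> nonconst (H - {Edge e\<^sub>2, Ghost e\<^sub>1})"
  shows "substitute (edge_shear e\<^sub>1 e\<^sub>2 P) x = x"
  using assms unfolding nonconst_def
  by (rule substitute_eq_self[where G = "H - {Edge e\<^sub>2, Ghost e\<^sub>1}"]) (auto simp: edge_shear_def)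

text \<open>Since the shear fixes \<open>P\<close>, the correction terms with \<open>P\<close> and
  \<open>- P\<close> cancel.\<close>

lemma substitute_edge_shear_uminus:
  assumes "e\<^sub>1 \<noteq> e\<^sub>2" "P \<in> nonconst (H - {Edge e\<^sub>2, Ghost e\<^sub>1})"
  shows "substitute (edge_shear e\<^sub>1 e\<^sub>2 P) (edge_shear e\<^sub>1 e\<^sub>2 (- P) g) = gen g"
proof -
  have "substitute (edge_shear e\<^sub>1 e\<^sub>2 P) P = P"
    by (rule substitute_edge_shear_eq_self) (rule assms)
  then show ?thesis
    using assms(1)
    by (simp add: edge_shear_def[of e\<^sub>1 e\<^sub>2 "- P"] substitute_add substitute_diff substitute_mult)
       (simp add: edge_shear_def)
qed

section \<open>Existence and uniqueness of the automorphism\<close>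

theorem corollary2p5:
  fixes E :: "('v, 'e) pre_digraph"
    and L :: "('k::field, ('v, 'e, 'k) lpa_elem) module"
    and p :: "('v, 'e, 'k) lpa_elem"
  defines "L \<equiv> leavitt_path_algebra E"
  assumes "wf_digraph E" and "finite (verts E)"
    and "v \<in> verts E" and "w \<in> verts E"
    and "e\<^sub>1 \<in> arcs E" and "e\<^sub>2 \<in> arcs E" and "e\<^sub>1 \<noteq> e\<^sub>2"
    and "tail E e\<^sub>1 = v" and "head E e\<^sub>1 = w"
    and "tail E e\<^sub>2 = v" and "head E e\<^sub>2 = w"
    and "p \<in> lpa_two_edge_subalgebra E e\<^sub>1 e\<^sub>2"
    and "lpa_vertex E w \<otimes>\<^bsub>L\<^esub> p = p \<otimes>\<^bsub>L\<^esub> lpa_vertex E w"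
  shows "\<exists>!\<sigma>. \<sigma> \<in> algebra_auto L \<and>
    \<sigma> (lpa_edge E e\<^sub>2) = lpa_edge E e\<^sub>2 \<oplus>\<^bsub>L\<^esub> lpa_edge E e\<^sub>1 \<otimes>\<^bsub>L\<^esub> p \<and>
    \<sigma> (lpa_ghost E e\<^sub>1) = lpa_ghost E e\<^sub>1 \<ominus>\<^bsub>L\<^esub> p \<otimes>\<^bsub>L\<^esub> lpa_ghost E e\<^sub>2 \<and>
    inv_into (carrier L) \<sigma> (lpa_edge E e\<^sub>2) =
      lpa_edge E e\<^sub>2 \<ominus>\<^bsub>L\<^esub> lpa_edge E e\<^sub>1 \<otimes>\<^bsub>L\<^esub> p \<and>
    inv_into (carrier L) \<sigma> (lpa_ghost E e\<^sub>1) =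
      lpa_ghost E e\<^sub>1 \<oplus>\<^bsub>L\<^esub> p \<otimes>\<^bsub>L\<^esub> lpa_ghost E e\<^sub>2 \<and>
    (\<forall>q \<in> lpa_two_edge_subalgebra E e\<^sub>1 e\<^sub>2. \<sigma> q = q)"
proof -
  interpret wf_digraph E
    by (rule assms)
  let ?H = "lpa_gens E - {Edge e\<^sub>2, Ghost e\<^sub>1}"
  let ?N = "nonconst (lpa_gens E) :: (('v, 'e) lpa_gen, 'k) ncpoly set"
  obtain P :: "(('v, 'e) lpa_gen, 'k) ncpoly" where P: "P \<in> nonconst ?H" and p: "p = lpa_class E P"
    using assms(13) by (rule two_edge_subalgebra_reps)
  have sub: "x \<in> ?N" if "x \<in> nonconst ?H" for x
    using that nonconst_mono[of ?H "lpa_gens E"] by blast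
  have PN: "P \<in> ?N"
    using P by (rule sub)
  have gens: "gen (Edge e\<^sub>1) \<in> ?N" "gen (Edge e\<^sub>2) \<in> ?N" "gen (Ghost e\<^sub>1) \<in> ?N" "gen (Ghost e\<^sub>2) \<in> ?N"
    using assms by simp_all
  have shear_N: "edge_shear e\<^sub>1 e\<^sub>2 Q g \<in> ?N" if "Q \<in> ?N" "g \<in> lpa_gens E" for Q g
    using that gens by (simp add: edge_shear_def nonconst_intros)
  \<comment> \<open>Commutation of \<open>p\<close> with \<open>w\<close> in the quotient becomes a
    congruence for the lift \<open>P\<close>.\<close>
  have comm: "gen (Vertex w) * P - P * gen (Vertex w) \<in> lpa_ideal E"
    using assms(14) \<open>w \<in> verts E\<close> PN
    by (simp add: p L_def lpa_vertex_def lpa_mult lpa_class_eq_iff)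
  then have comm': "gen (Vertex w) * (- P) - (- P) * gen (Vertex w) \<in> lpa_ideal E"
    using lpa_ideal_uminus[OF comm] by simp
  have rel: "substitute (edge_shear e\<^sub>1 e\<^sub>2 P) r \<in> lpa_ideal E"
    "substitute (edge_shear e\<^sub>1 e\<^sub>2 (- P)) r \<in> lpa_ideal E" if "r \<in> lpa_relators E" for r
    using assms PN comm comm' that
    by (auto intro!: substitute_edge_shear_relator simp: nonconst_uminus)
  \<comment> \<open>The second composite is the first one with \<open>- P\<close> in place of
    \<open>P\<close>.\<close>
  have inverse: "substitute (edge_shear e\<^sub>1 e\<^sub>2 P) (edge_shear e\<^sub>1 e\<^sub>2 (- P) g) = gen g"
    "substitute (edge_shear e\<^sub>1 e\<^sub>2 (- P)) (edge_shear e\<^sub>1 e\<^sub>2 P g) = gen g" for g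
    using substitute_edge_shear_uminus[OF \<open>e\<^sub>1 \<noteq> e\<^sub>2\<close> P]
      substitute_edge_shear_uminus[OF \<open>e\<^sub>1 \<noteq> e\<^sub>2\<close> nonconst_uminus[OF P]] by simp_all
  obtain \<sigma> where auto: "\<sigma> \<in> algebra_auto L"
    and \<sigma>: "\<And>x. x \<in> ?N \<Longrightarrow> \<sigma> (lpa_class E x) = lpa_class E (substitute (edge_shear e\<^sub>1 e\<^sub>2 P) x)"
    and inv: "\<And>x. x \<in> ?N \<Longrightarrow>
      inv_into (carrier L) \<sigma> (lpa_class E x) = lpa_class E (substitute (edge_shear e\<^sub>1 e\<^sub>2 (- P)) x)"
    unfolding L_def
    using algebra_auto_of_substitutions[of "edge_shear e\<^sub>1 e\<^sub>2 P" "edge_shear e\<^sub>1 e\<^sub>2 (- P)"]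
      shear_N[OF PN] shear_N[OF nonconst_uminus[OF PN]] rel inverse
    by (auto simp: edge_shear_def[of _ _ _ "Vertex _"])
  show ?thesis
  proof (rule ex1I[of _ \<sigma>], intro conjI ballI)
    show "\<sigma> \<in> algebra_auto L"
      by (rule auto)
    show "\<sigma> (lpa_edge E e\<^sub>2) = lpa_edge E e\<^sub>2 \<oplus>\<^bsub>L\<^esub> lpa_edge E e\<^sub>1 \<otimes>\<^bsub>L\<^esub> p"
      "\<sigma> (lpa_ghost E e\<^sub>1) = lpa_ghost E e\<^sub>1 \<ominus>\<^bsub>L\<^esub> p \<otimes>\<^bsub>L\<^esub> lpa_ghost E e\<^sub>2"
      "inv_into (carrier L) \<sigma> (lpa_edge E e\<^sub>2) = lpa_edge E e\<^sub>2 \<ominus>\<^bsub>L\<^esub> lpa_edge E e\<^sub>1 \<otimes>\<^bsub>L\<^esub> p"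
      "inv_into (carrier L) \<sigma> (lpa_ghost E e\<^sub>1) = lpa_ghost E e\<^sub>1 \<oplus>\<^bsub>L\<^esub> p \<otimes>\<^bsub>L\<^esub> lpa_ghost E e\<^sub>2"
      using gens PN
      by (simp_all add: \<sigma> inv lpa_edge_def lpa_ghost_def p edge_shear_def)
         (simp_all add: L_def lpa_add lpa_mult lpa_minus nonconst_mult)
    fix q :: "('v, 'e, 'k) lpa_elem"
    assume "q \<in> lpa_two_edge_subalgebra E e\<^sub>1 e\<^sub>2"
    then obtain x where "x \<in> nonconst ?H" "q = lpa_class E x"
      by (rule two_edge_subalgebra_reps)
    then show "\<sigma> q = q"
      by (simp add: \<sigma> sub substitute_edge_shear_eq_self)
  next
    fix \<tau>
    assume \<tau>: "\<tau> \<in> algebra_auto L \<and>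
      \<tau> (lpa_edge E e\<^sub>2) = lpa_edge E e\<^sub>2 \<oplus>\<^bsub>L\<^esub> lpa_edge E e\<^sub>1 \<otimes>\<^bsub>L\<^esub> p \<and>
      \<tau> (lpa_ghost E e\<^sub>1) = lpa_ghost E e\<^sub>1 \<ominus>\<^bsub>L\<^esub> p \<otimes>\<^bsub>L\<^esub> lpa_ghost E e\<^sub>2 \<and>
      inv_into (carrier L) \<tau> (lpa_edge E e\<^sub>2) = lpa_edge E e\<^sub>2 \<ominus>\<^bsub>L\<^esub> lpa_edge E e\<^sub>1 \<otimes>\<^bsub>L\<^esub> p \<and>
      inv_into (carrier L) \<tau> (lpa_ghost E e\<^sub>1) = lpa_ghost E e\<^sub>1 \<oplus>\<^bsub>L\<^esub> p \<otimes>\<^bsub>L\<^esub> lpa_ghost E e\<^sub>2 \<and>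
      (\<forall>q \<in> lpa_two_edge_subalgebra E e\<^sub>1 e\<^sub>2. \<tau> q = q)"
    \<comment> \<open>All generators other than the two moved ones lie in the subalgebra, so
      \<open>\<tau>\<close> fixes them; on the remaining two its values are prescribed.\<close>
    have fixed: "lpa_class E (gen g) \<in> (lpa_two_edge_subalgebra E e\<^sub>1 e\<^sub>2 :: ('v, 'e, 'k) lpa_elem set)"
      if "g \<in> ?H" for g
      using that unfolding lpa_two_edge_subalgebra_def generated_subalgebra_def lpa_gens_def
        lpa_vertex_def lpa_edge_def lpa_ghost_def
      by auto
    have "\<tau> (lpa_class E (gen g)) = \<sigma> (lpa_class E (gen g))" if "g \<in> lpa_gens E" for g
    proof (cases "g \<in> ?H")
      case True
      then have "substitute (edge_shear e\<^sub>1 e\<^sub>2 P) (gen g) = gen g"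
        by (auto simp: edge_shear_def)
      then show ?thesis
        using \<tau> fixed[OF True] \<sigma>[OF gen_in_nonconst[OF that]] by simp
    next
      case False
      with that consider "g = Edge e\<^sub>2" | "g = Ghost e\<^sub>1"
        by blast
      then show ?thesis
        using \<tau> gens PN
        by cases
          (simp_all add: \<sigma> lpa_edge_def lpa_ghost_def p edge_shear_def L_def
            lpa_add lpa_mult lpa_minus nonconst_mult)
    qed
    then show "\<tau> = \<sigma>"
      using \<tau> auto unfolding L_def by (intro algebra_auto_eqI) auto
  qed
qed

end
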